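(* Let $n,s,d\ge 1$ be integers, let $\bm{X}=[\bm{x}_1,\dots,\bm{x}_s]\in\mathbb{R}^{n\times s}$ be a real matrix, let $\mathcal{X}=\{\bm{x}_1,\dots,\bm{x}_s\}\subset\mathbb{R}^n$ be the set of its columns, and let $N=\binom{n+d}{d}$. Then $$\operatorname{rank}\,\phi_d(\bm{X})=\min(R,s),\qquad\text{where } R=\dim\mathcal{S}_d(\mathcal{X})=N-\dim\mathcal{I}_d(\mathcal{X}).$$ Moreover, if $\mathcal{X}$ is a subset of a real affine algebraic variety $V\subset\mathbb{R}^n$, then $$\operatorname{rank}\,\phi_d(\bm{X})\le\dim\mathcal{S}_d(V).$$
   Context: For $\bm{x}=(x_1,\dots,x_n)\in\mathbb{R}^n$ and an integer $d\ge 1$, $\phi_d(\bm{x})=(\bm{x}^{\bm{\alpha}})_{|\bm{\alpha}|\le d}\in\mathbb{R}^N$ is the vector of all monomials in $x_1,\dots,x_n$ of degree at most $d$, where $\bm{\alpha}$ ranges over multi-indices of non-negative integers with $|\bm{\alpha}|:=\alpha_1+\cdots+\alpha_n\le d$ and $\bm{x}^{\bm{\alpha}}:=x_1^{\alpha_1}\cdots x_n^{\alpha_n}$. For $\bm{X}=[\bm{x}_1,\dots,\bm{x}_s]\in\mathbb{R}^{n\times s}$, $\phi_d(\bm{X})$ is the $N\times s$ matrix $[\phi_d(\bm{x}_1),\dots,\phi_d(\bm{x}_s)]$. Let $\mathbb{R}[\bm{x}]$ be the space of real polynomials in $n$ variables, and $\mathbb{R}_d[\bm{x}]$ the $N$-dimensional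 subspace of polynomials of degree at most $d$. A real affine algebraic variety is a set of the form $V(P)=\{\bm{x}\in\mathbb{R}^n: f(\bm{x})=0\text{ for all }f\in P\}$ for some $P\subset\mathbb{R}[\bm{x}]$. For a set $\mathcal{Y}\subset\mathbb{R}^n$, define the vanishing ideal of degree $d$ as the linear subspace $\mathcal{I}_d(\mathcal{Y}):=\{f\in\mathbb{R}_d[\bm{x}]: f(\bm{x})=0\text{ for all }\bm{x}\in\mathcal{Y}\}$. Define the non-vanishing ideal of degree $d$ as its orthogonal complement $\mathcal{S}_d(\mathcal{Y}):=\{g\in\mathbb{R}_d[\bm{x}]:\langle f,g\rangle=0\text{ for all }f\in\mathcal{I}_d(\mathcal{Y})\}$, where $\langle f,g\rangle$ is the Euclidean inner product of the coefficient vectors of $f$ and $g$ in the monomial basis. *)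

theory Defs
  imports "Jordan_Normal_Form.DL_Rank" "HOL-Analysis.Finite_Function_Topology"
begin

text \<open>
  A real polynomial is a finitely supported map from exponents to coefficients, of type
  \<open>(nat \<Rightarrow>\<^sub>0 nat) \<Rightarrow>\<^sub>0 real\<close>. The variables of \<open>\<real>[x\<^sub>0, \<dots>, x\<^sub>n\<^sub>-\<^sub>1]\<close> are numbered from \<open>0\<close>,
  so that they match the coordinates of the vectors in \<open>carrier_vec n\<close>.
\<close>

type_synonym exponent = "nat \<Rightarrow>\<^sub>0 nat"
type_synonym rpoly = "exponent \<Rightarrow>\<^sub>0 real"

definition multi_indices :: "nat \<Rightarrow> exponent set" where
  "multi_indices n = {\<alpha>. Poly_Mapping.keys \<alpha> \<subseteq> {..<n}}"

definition total_deg :: "nat \<Rightarrow> exponent \<Rightarrow> nat" where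
  "total_deg n \<alpha> = (\<Sum>i<n. Poly_Mapping.lookup \<alpha> i)"

definition multi_indices_upto :: "nat \<Rightarrow> nat \<Rightarrow> exponent set" where
  "multi_indices_upto n d = {\<alpha> \<in> multi_indices n. total_deg n \<alpha> \<le> d}"

definition monomial_eval :: "nat \<Rightarrow> real vec \<Rightarrow> exponent \<Rightarrow> real" where
  "monomial_eval n x \<alpha> = (\<Prod>i<n. vec_index x i ^ Poly_Mapping.lookup \<alpha> i)"

text \<open>
  The coordinates of \<open>phi n d x\<close> are ordered by the linear order on \<open>nat \<Rightarrow>\<^sub>0 nat\<close>.
  This choice only permutes the rows of \<open>phi_mat n d X\<close>.
\<close>

definition phi :: "nat \<Rightarrow> nat \<Rightarrow> real vec \<Rightarrow> real vec" where
  "phi n d x =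
     vec_of_list (map (monomial_eval n x) (sorted_list_of_set (multi_indices_upto n d)))"

definition phi_mat :: "nat \<Rightarrow> nat \<Rightarrow> real mat \<Rightarrow> real mat" where
  "phi_mat n d X = mat_of_cols ((n + d) choose d) (map (phi n d) (cols X))"

definition polys :: "nat \<Rightarrow> rpoly set" where
  "polys n = {f. Poly_Mapping.keys f \<subseteq> multi_indices n}"

definition polys_upto :: "nat \<Rightarrow> nat \<Rightarrow> rpoly set" where
  "polys_upto n d = {f. Poly_Mapping.keys f \<subseteq> multi_indices_upto n d}"

definition poly_eval :: "nat \<Rightarrow> rpoly \<Rightarrow> real vec \<Rightarrow> real" where
  "poly_eval n f x = (\<Sum>\<alpha>\<in>Poly_Mapping.keys f. Poly_Mapping.lookup f \<alpha> * monomial_eval n x \<alpha>)"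

definition coeff_inner :: "nat \<Rightarrow> nat \<Rightarrow> rpoly \<Rightarrow> rpoly \<Rightarrow> real" where
  "coeff_inner n d f g =
     (\<Sum>\<alpha>\<in>multi_indices_upto n d. Poly_Mapping.lookup f \<alpha> * Poly_Mapping.lookup g \<alpha>)"

definition real_affine_variety :: "nat \<Rightarrow> real vec set \<Rightarrow> bool" where
  "real_affine_variety n V \<longleftrightarrow>
     (\<exists>P \<subseteq> polys n. V = {x \<in> carrier_vec n. \<forall>f\<in>P. poly_eval n f x = 0})"

definition vanishing_ideal :: "nat \<Rightarrow> nat \<Rightarrow> real vec set \<Rightarrow> rpoly set" where
  "vanishing_ideal n d Y = {f \<in> polys_upto n d. \<forall>x\<in>Y. poly_eval n f x = 0}"

definition nonvanishing_ideal :: "nat \<Rightarrow> nat \<Rightarrow> real vec set \<Rightarrow> rpoly set" where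
  "nonvanishing_ideal n d Y =
     {g \<in> polys_upto n d. \<forall>f\<in>vanishing_ideal n d Y. coeff_inner n d f g = 0}"

text \<open>
  There are \<open>(n + d) choose d\<close> multi-indices of degree at most \<open>d\<close>, so the number of rows
  prescribed in \<open>phi_mat\<close> is the length of the vectors \<open>phi n d x\<close>.
\<close>

lemma bij_betw_multi_indices_upto:
  "bij_betw (\<lambda>\<alpha>. (d - total_deg n \<alpha>) # map (Poly_Mapping.lookup \<alpha>) [0..<n])
     (multi_indices_upto n d) {xs. length xs = Suc n \<and> sum_list xs = d}"
proof (rule bij_betwI')
  fix \<alpha> \<beta> assume ab: "\<alpha> \<in> multi_indices_upto n d" "\<beta> \<in> multi_indices_upto n d"
  have "\<alpha> = \<beta>" if eq: "map (Poly_Mapping.lookup \<alpha>) [0..<n] = map (Poly_Mapping.lookup \<beta>) [0..<n]"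
  proof (rule poly_mapping_eqI)
    fix i
    have z: "i \<ge> n \<Longrightarrow> Poly_Mapping.lookup \<alpha> i = 0 \<and> Poly_Mapping.lookup \<beta> i = 0"
      using ab by (auto simp: multi_indices_upto_def multi_indices_def subset_iff in_keys_iff
          not_less[symmetric])
    show "Poly_Mapping.lookup \<alpha> i = Poly_Mapping.lookup \<beta> i"
      using z eq by (cases "i < n") auto
  qed
  thus "((d - total_deg n \<alpha>) # map (Poly_Mapping.lookup \<alpha>) [0..<n]
      = (d - total_deg n \<beta>) # map (Poly_Mapping.lookup \<beta>) [0..<n]) = (\<alpha> = \<beta>)"
    by auto
next
  fix \<alpha> assume "\<alpha> \<in> multi_indices_upto n d"
  thus "(d - total_deg n \<alpha>) # map (Poly_Mapping.lookup \<alpha>) [0..<n]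
      \<in> {xs. length xs = Suc n \<and> sum_list xs = d}"
    by (auto simp: multi_indices_upto_def total_deg_def interv_sum_list_conv_sum_set_nat
        atLeast0LessThan)
next
  fix xs :: "nat list" assume "xs \<in> {xs. length xs = Suc n \<and> sum_list xs = d}"
  then obtain y ys where xs: "xs = y # ys" "length ys = n" "y + sum_list ys = d"
    by (cases xs) auto
  define f where "f = (\<lambda>i. if i < n then ys ! i else 0)"
  have fin: "finite {i. f i \<noteq> 0}"
    by (rule finite_subset[of _ "{..<n}"]) (auto simp: f_def)
  define \<alpha> where "\<alpha> = Abs_poly_mapping f"
  have l: "Poly_Mapping.lookup \<alpha> = f"
    unfolding \<alpha>_def using fin by simp
  have t: "total_deg n \<alpha> = sum_list ys"
    unfolding total_deg_def l f_def by (simp add: sum_list_sum_nth xs(2) atLeast0LessThan)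
  have "\<alpha> \<in> multi_indices_upto n d"
    using xs t by (auto simp: multi_indices_upto_def multi_indices_def in_keys_iff l f_def split: if_splits)
  moreover have "xs = (d - total_deg n \<alpha>) # map (Poly_Mapping.lookup \<alpha>) [0..<n]"
    unfolding t l using xs by (auto simp: f_def intro!: nth_equalityI)
  ultimately show "\<exists>\<alpha>\<in>multi_indices_upto n d.
      xs = (d - total_deg n \<alpha>) # map (Poly_Mapping.lookup \<alpha>) [0..<n]" by blast
qed

lemma card_multi_indices_upto: "card (multi_indices_upto n d) = (n + d) choose d"
  using bij_betw_same_card[OF bij_betw_multi_indices_upto, of n d]
  by (simp add: card_length_sum_list add.commute)

lemma finite_multi_indices_upto: "finite (multi_indices_upto n d)"
  using card_multi_indices_upto[of n d] by (simp add: card_ge_0_finite)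

lemma phi_carrier: "phi n d x \<in> carrier_vec ((n + d) choose d)"
  by (rule carrier_vecI) (simp add: phi_def card_multi_indices_upto)

end

theory Submission
  imports Defs "HOL-Analysis.Linear_Algebra"
begin

text \<open>
  Identify \<open>phi n d x\<close> with the polynomial \<open>phi_poly n d x\<close> having the same coefficients. Evaluating
  a polynomial of degree at most \<open>d\<close> at \<open>x\<close> is then taking its inner product with
  \<open>phi_poly n d x\<close>, so the vanishing ideal is the orthogonal complement of the span of the columns of
  \<open>phi_mat n d X\<close>. Its own orthogonal complement has the same dimension as that span,
  which is the rank, and it grows with the point set.
\<close>

section \<open>Orthogonal complements in finitely generated real vector spaces\<close>

text \<open>The elements of \<open>C\<close> are added to \<open>B\<close> one at a time. If the
  next \<open>c\<close> were \<open>x + y\<close> with \<open>x\<close> in \<open>span B\<close> and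
  \<open>y\<close> in \<open>span C\<close>, then \<open>x = c - y\<close> would lie in both spans,
  hence vanish, leaving \<open>c\<close> in \<open>span C\<close>.\<close>

lemma independent_Un:
  fixes B C :: "'a::real_vector set"
  assumes B: "independent B" and C: "independent C" and fin: "finite C"
    and disj: "span B \<inter> span C = {0}"
  shows "independent (B \<union> C)"
  using fin C disj
proof (induction C)
  case empty
  then show ?case using B by simp
next
  case (insert c C)
  have sub: "span C \<subseteq> span (insert c C)" by (rule span_mono) auto
  have c: "independent C" "c \<notin> span C"
    using insert.prems(1) insert.hyps(2) by (auto simp: independent_insert)
  have "span B \<inter> span C = {0}"
    using insert.prems(2) sub span_zero by blast
  with insert.IH c have ind: "independent (B \<union> C)" by blast
  have "c \<notin> span (B \<union> C)"
  proof
    assume "c \<in> span (B \<union> C)"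
    then obtain x y where xy: "c = x + y" "x \<in> span B" "y \<in> span C"
      by (auto simp: span_Un)
    have "x = c - y" using xy by simp
    moreover have "c - y \<in> span (insert c C)"
      using xy sub by (intro span_diff) (auto intro: span_base)
    ultimately have "x = 0" using xy insert.prems(2) by blast
    with xy c show False by simp
  qed
  then show ?case using ind by (simp add: independent_insertI)
qed

text \<open>The space of all polynomials is infinite-dimensional, so finiteness of a basis has to
  come from a finite spanning set \<open>E\<close>, which bounds the size of every independent
  subset of \<open>span E\<close>.\<close>

lemma finite_basis:
  fixes P E :: "'a::real_vector set"
  assumes "P \<subseteq> span E" "finite E"
  obtains B where "B \<subseteq> P" "independent B" "P \<subseteq> span B" "card B = dim P" "finite B"
proof -
  obtain B where B: "B \<subseteq> P" "independent B" "P \<subseteq> span B" "card B = dim P"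
    by (rule real_vector.basis_exists)
  have "finite B"
    using real_vector.independent_span_bound[OF assms(2) B(2)] B(1) assms(1) by blast
  with B show ?thesis by (rule that)
qed

text \<open>A finite basis of \<open>T\<close> spans \<open>S\<close>. The finite set
  \<open>E\<close> matters because \<open>dim\<close> is 0 for a space without a finite
  basis.\<close>

lemma dim_mono_finite:
  fixes S T E :: "'a::real_vector set"
  assumes "S \<subseteq> T" "T \<subseteq> span E" "finite E"
  shows "dim S \<le> dim T"
proof -
  obtain C where C: "C \<subseteq> T" "independent C" "T \<subseteq> span C" "card C = dim T" "finite C"
    by (rule finite_basis[OF assms(2,3)])
  show ?thesis
    using real_vector.dim_le_card[of S C] assms(1) C by auto
qed

text \<open>Gram-Schmidt by induction on \<open>B\<close>. Definiteness is assumed on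
  \<open>span B\<close> alone because \<open>coeff_inner n d\<close> ignores coefficients outside
  \<open>multi_indices_upto n d\<close> and so is degenerate on the whole type.\<close>

lemma orthogonal_projection_exists:
  fixes ip :: "'a::real_vector \<Rightarrow> 'a \<Rightarrow> real"
  assumes bil: "bilinear ip"
    and "finite B" and "\<And>x. x \<in> span B \<Longrightarrow> ip x x = 0 \<Longrightarrow> x = 0"
  shows "\<exists>w\<in>span B. \<forall>b\<in>B. ip (x - w) b = 0"
  using assms(2,3)
proof (induction B arbitrary: x)
  case empty
  then show ?case by auto
next
  case (insert b B)
  have sub: "span B \<subseteq> span (insert b B)" by (rule span_mono) auto
  with insert.prems have IH: "\<exists>w\<in>span B. \<forall>b\<in>B. ip (x - w) b = 0" for x
    by (intro insert.IH) blast
  \<comment> \<open>The induction hypothesis is used twice: on \<open>b\<close>, to get its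
    component \<open>e\<close> orthogonal to \<open>B\<close>, and on \<open>x\<close>.\<close>
  obtain v where v: "v \<in> span B" "\<forall>a\<in>B. ip (b - v) a = 0" using IH[of b] by blast
  obtain w where w: "w \<in> span B" "\<forall>a\<in>B. ip (x - w) a = 0" using IH[of x] by blast
  define e where "e = b - v"
  have e: "e \<in> span (insert b B)" "\<forall>a\<in>B. ip e a = 0"
    using v sub unfolding e_def by (auto intro!: span_diff intro: span_base)
  have orth_span: "ip u v = 0" if "\<forall>a\<in>B. ip u a = 0" for u
    using v(1) that
  proof (induction rule: span_induct_alt)
    case base
    then show ?case using bil by (simp add: bilinear_rzero)
  next
    case (step c y z)
    then show ?case using bil by (simp add: bilinear_radd bilinear_rmul)
  qed
  \<comment> \<open>One Gram-Schmidt step; if \<open>e = 0\<close> the quotient is \<open>0\<close> and the formula still works.\<close>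
  define w' where "w' = w + (ip (x - w) e / ip e e) *\<^sub>R e"
  have eq: "ip (x - w') u = ip (x - w) u - ip (x - w) e / ip e e * ip e u" for u
    unfolding w'_def using bil
    by (simp add: bilinear_lsub bilinear_ladd bilinear_lmul)
  have "w' \<in> span (insert b B)"
    unfolding w'_def using w sub e by (auto intro!: span_add span_scale)
  moreover have old: "\<forall>a\<in>B. ip (x - w') a = 0"
    using w e by (simp add: eq)
  moreover have "ip (x - w') b = 0"
  proof -
    have "ip (x - w') e = 0"
    proof (cases "ip e e = 0")
      case True
      then have "e = 0" using insert.prems e by blast
      then show ?thesis using bil by (simp add: bilinear_rzero)
    qed (simp add: eq)
    moreover have "ip (x - w') v = 0" using orth_span old by blast
    moreover have "b = e + v" by (simp add: e_def)
    ultimately show ?thesis using bil by (simp add: bilinear_radd)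
  qed
  ultimately show ?case by blast
qed

text \<open>A basis of \<open>W\<close> and a basis of the complement together form a basis of
  \<open>P\<close>: definiteness makes their spans meet only in 0, and projection splits every
  element of \<open>P\<close>. A mere subset \<open>W\<close> is allowed, so that it can be a set of
  evaluation vectors.\<close>

lemma dim_orthogonal_complement:
  fixes ip :: "'a::real_vector \<Rightarrow> 'a \<Rightarrow> real"
  assumes bil: "bilinear ip" and sym: "\<And>x y. ip x y = ip y x"
    and P: "subspace P" "P \<subseteq> span E" "finite E"
    and definite: "\<And>x. x \<in> P \<Longrightarrow> ip x x = 0 \<Longrightarrow> x = 0"
    and W: "W \<subseteq> P"
  shows "dim {u \<in> P. \<forall>w\<in>W. ip w u = 0} + dim W = dim P"
proof -
  let ?U = "{u \<in> P. \<forall>w\<in>W. ip w u = 0}"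
  obtain B where B: "B \<subseteq> W" "independent B" "W \<subseteq> span B" "card B = dim W" "finite B"
    using finite_basis[of W E] P W by blast
  have spanB: "span B \<subseteq> P" using B W P(1) by (meson span_minimal subset_trans)
  obtain C where C: "C \<subseteq> ?U" "independent C" "?U \<subseteq> span C" "card C = dim ?U" "finite C"
    using finite_basis[of ?U E] P by blast
  have subU: "subspace ?U"
    using P(1) bil unfolding subspace_def
    by (auto simp: bilinear_rzero bilinear_radd bilinear_rmul)
  have spanC: "span C \<subseteq> ?U" using C subU by (meson span_minimal)
  have orth: "ip w u = 0" if "w \<in> span B" "\<forall>a\<in>B. ip a u = 0" for w u
    using that
  proof (induction rule: span_induct_alt)
    case base
    then show ?case using bil by (simp add: bilinear_lzero)
  next
    case (step c y z)
    then show ?case using bil by (simp add: bilinear_ladd bilinear_lmul)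
  qed
  have disj: "span B \<inter> span C = {0}"
  proof -
    have "x = 0" if "x \<in> span B" "x \<in> span C" for x
    proof -
      have "ip x x = 0"
        using that spanC B(1) by (intro orth) auto
      then show ?thesis using that spanB definite by blast
    qed
    then show ?thesis by (auto simp: span_zero)
  qed
  have ind: "independent (B \<union> C)"
    using B C disj by (intro independent_Un) auto
  \<comment> \<open>Needed to add the cardinalities; an independent set does not contain the one
    common vector 0.\<close>
  have disjBC: "B \<inter> C = {}"
  proof -
    have "B \<inter> C \<subseteq> {0}" using disj by (auto dest: span_base)
    moreover have "0 \<notin> B" using B(2) dependent_zero by blast
    ultimately show ?thesis by blast
  qed
  have "P \<subseteq> span (B \<union> C)"
  proof
    fix x assume x: "x \<in> P"
    have "\<exists>w\<in>span B. \<forall>b\<in>B. ip (x - w) b = 0"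
      using spanB definite B(5) by (intro orthogonal_projection_exists[OF bil]) auto
    then obtain w where w: "w \<in> span B" "\<forall>b\<in>B. ip (x - w) b = 0" by blast
    have "\<forall>a\<in>B. ip a (x - w) = 0" using w sym by metis
    then have "x - w \<in> ?U"
      using x w spanB P(1) B(3) orth by (auto intro: subspace_diff)
    then have "x - w \<in> span C" using C by blast
    moreover have "x = w + (x - w)" by simp
    ultimately show "x \<in> span (B \<union> C)" using w unfolding span_Un by blast
  qed
  then have "dim P = card (B \<union> C)"
    using ind B C W by (intro real_vector.dim_unique) auto
  then show ?thesis using B C disjBC by (simp add: card_Un_disjoint)
qed

section \<open>The rank of a matrix as a real dimension\<close>

text \<open>This links the carrier-based \<open>rank\<close> to the type-based \<open>dim\<close>.
  On \<open>carrier_vec n\<close> the map \<open>g\<close> is linear and injective, so it preserves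
  and reflects dependence and sends a maximal independent set of columns to a basis of the span of
  the image.\<close>

lemma rank_eq_dim_linear_image:
  fixes A :: "real mat" and g :: "real vec \<Rightarrow> 'b::real_vector" and e :: "nat \<Rightarrow> 'b"
  assumes A: "A \<in> carrier_mat n nc"
    and e: "inj_on e {..<n}" "independent (e ` {..<n})"
    and g: "\<And>v. v \<in> carrier_vec n \<Longrightarrow> g v = (\<Sum>i<n. v $ i *\<^sub>R e i)"
  shows "vec_space.rank n A = real_vector.dim (g ` set (cols A))"
proof -
  interpret vec_space "TYPE(real)" n .
  have g_eq_0: "v = 0\<^sub>v n" if v: "v \<in> carrier_vec n" "g v = 0" for v
  proof (rule eq_vecI)
    fix i assume i: "i < dim_vec (0\<^sub>v n :: real vec)"
    \<comment> \<open>Coefficients are reindexed by the vectors \<open>e i\<close> themselves, the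
      form that \<open>independentD\<close> expects.\<close>
    have "(\<Sum>b\<in>e ` {..<n}. v $ (the_inv_into {..<n} e b) *\<^sub>R b) = 0"
      using v g e by (simp add: sum.reindex the_inv_into_f_f)
    then have "v $ (the_inv_into {..<n} e (e i)) = 0"
      using independentD[OF e(2), of "e ` {..<n}" "\<lambda>b. v $ (the_inv_into {..<n} e b)" "e i"] i
      by auto
    then show "v $ i = 0\<^sub>v n $ i" using e i by (simp add: the_inv_into_f_f)
  qed (use v in auto)
  have g_lincomb: "g (lincomb a T) = (\<Sum>x\<in>T. a x *\<^sub>R g x)" if T: "T \<subseteq> carrier_vec n" "finite T" for a T
  proof -
    have "lincomb a T \<in> carrier_vec n" using T by (simp add: lincomb_closed)
    then have "g (lincomb a T) = (\<Sum>i<n. (\<Sum>x\<in>T. a x * x $ i) *\<^sub>R e i)"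
      using T by (simp add: g lincomb_index)
    also have "\<dots> = (\<Sum>x\<in>T. a x *\<^sub>R (\<Sum>i<n. x $ i *\<^sub>R e i))"
      by (simp add: scaleR_sum_left scaleR_sum_right sum.swap[of _ T])
    also have "\<dots> = (\<Sum>x\<in>T. a x *\<^sub>R g x)"
      using T g by (intro sum.cong) auto
    finally show ?thesis .
  qed
  have inj: "inj_on g (carrier_vec n)"
  proof (rule inj_onI)
    fix u v assume uv: "u \<in> carrier_vec n" "v \<in> carrier_vec n" "g u = g v"
    have "g (u - v) = g u - g v"
      using uv by (simp add: g scaleR_diff_left sum_subtractf)
    then have "u - v = 0\<^sub>v n" using uv by (intro g_eq_0) auto
    show "u = v"
    proof (rule eq_vecI)
      fix i assume "i < dim_vec v"
      then show "u $ i = v $ i"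
        using arg_cong[OF \<open>u - v = 0\<^sub>v n\<close>, of "\<lambda>w. w $ i"] uv by simp
    qed (use uv in auto)
  qed
  have dep: "lin_dep T \<longleftrightarrow> dependent (g ` T)" if T: "T \<subseteq> carrier_vec n" "finite T" for T
  proof -
    have injT: "inj_on g T" using inj T by (meson inj_on_subset)
    \<comment> \<open>For finite \<open>T\<close>, a dependence on some subset extends by zero
      coefficients to one over all of \<open>T\<close>.\<close>
    have "lin_dep T \<longleftrightarrow> (\<exists>a. (\<exists>v\<in>T. a v \<noteq> 0) \<and> lincomb a T = 0\<^sub>v n)"
    proof
      assume "lin_dep T"
      then show "\<exists>a. (\<exists>v\<in>T. a v \<noteq> 0) \<and> lincomb a T = 0\<^sub>v n"
        using finite_lin_dep[OF T(2)] T by auto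
    next
      assume "\<exists>a. (\<exists>v\<in>T. a v \<noteq> 0) \<and> lincomb a T = 0\<^sub>v n"
      then show "lin_dep T" unfolding lin_dep_def using T by auto
    qed
    also have "\<dots> \<longleftrightarrow> (\<exists>a. (\<exists>v\<in>T. a v \<noteq> 0) \<and> (\<Sum>x\<in>T. a x *\<^sub>R g x) = 0)"
    proof -
      have "lincomb a T = 0\<^sub>v n \<longleftrightarrow> (\<Sum>x\<in>T. a x *\<^sub>R g x) = 0" for a
        using g_eq_0[of "lincomb a T"] g_lincomb[OF T, of a] g[of "0\<^sub>v n"] lincomb_closed[of T a] T
        by auto
      then show ?thesis by simp
    qed
    \<comment> \<open>Injectivity of \<open>g\<close> on \<open>T\<close> lets coefficients move
      between \<open>T\<close> and its image without merging vectors.\<close>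
    also have "\<dots> \<longleftrightarrow> (\<exists>u. (\<exists>b\<in>g ` T. u b \<noteq> 0) \<and> (\<Sum>b\<in>g ` T. u b *\<^sub>R b) = 0)"
    proof
      assume "\<exists>a. (\<exists>v\<in>T. a v \<noteq> 0) \<and> (\<Sum>x\<in>T. a x *\<^sub>R g x) = 0"
      then obtain a where a: "\<exists>v\<in>T. a v \<noteq> 0" "(\<Sum>x\<in>T. a x *\<^sub>R g x) = 0" by blast
      show "\<exists>u. (\<exists>b\<in>g ` T. u b \<noteq> 0) \<and> (\<Sum>b\<in>g ` T. u b *\<^sub>R b) = 0"
        by (rule exI[of _ "\<lambda>b. a (the_inv_into T g b)"])
          (use a injT in \<open>simp add: sum.reindex the_inv_into_f_f\<close>)
    next
      assume "\<exists>u. (\<exists>b\<in>g ` T. u b \<noteq> 0) \<and> (\<Sum>b\<in>g ` T. u b *\<^sub>R b) = 0"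
      then obtain u where "\<exists>b\<in>g ` T. u b \<noteq> 0" "(\<Sum>b\<in>g ` T. u b *\<^sub>R b) = 0" by blast
      then show "\<exists>a. (\<exists>v\<in>T. a v \<noteq> 0) \<and> (\<Sum>x\<in>T. a x *\<^sub>R g x) = 0"
        using injT by (intro exI[of _ "\<lambda>x. u (g x)"]) (simp add: sum.reindex)
    qed
    also have "\<dots> \<longleftrightarrow> dependent (g ` T)"
      using T by (simp add: real_vector.dependent_finite)
    finally show ?thesis .
  qed
  let ?S = "set (cols A)"
  have S: "?S \<subseteq> carrier_vec n" using A cols_dim by blast
  have "lin_indpt {}" using dep[of "{}"] independent_empty by simp
  then obtain U where U: "finite U" "maximal U (\<lambda>T. T \<subseteq> ?S \<and> lin_indpt T)"
    using maximal_exists_superset[of ?S "\<lambda>T. T \<subseteq> ?S \<and> lin_indpt T" "{}"] by auto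
  have US: "U \<subseteq> ?S" "lin_indpt U" using U(2) by (auto simp: maximal_def)
  have injU: "inj_on g U" using inj US S by (meson inj_on_subset subset_trans)
  have ind: "independent (g ` U)" using dep[of U] US S U(1) by auto
  \<comment> \<open>A column whose image lay outside this span could be added to \<open>U\<close>,
    against maximality.\<close>
  have "g x \<in> real_vector.span (g ` U)" if x: "x \<in> ?S" for x
  proof (rule ccontr)
    assume nin: "g x \<notin> real_vector.span (g ` U)"
    then have "independent (g ` insert x U)" using ind by (simp add: independent_insertI)
    then have "lin_indpt (insert x U)" using dep[of "insert x U"] US S U(1) x by auto
    moreover have "insert x U \<subseteq> ?S" using x US by blast
    ultimately have "insert x U = U" using U(2) unfolding maximal_def by blast
    then show False using nin by (metis image_eqI insertI1 real_vector.span_base)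
  qed
  then have "real_vector.dim (g ` ?S) = card (g ` U)"
    using ind US by (intro real_vector.dim_unique) auto
  also have "\<dots> = card U" using injU by (rule card_image)
  finally show ?thesis using rank_card_indpt[OF A U(2)] by simp
qed

section \<open>Polynomials of bounded degree\<close>

lemma lookup_scaleR: "Poly_Mapping.lookup (c *\<^sub>R f) k = c *\<^sub>R Poly_Mapping.lookup f k"
proof -
  have "finite {i. c *\<^sub>R Poly_Mapping.lookup f i \<noteq> 0}"
    by (rule finite_subset[OF _ finite_keys[of f]]) (auto simp: in_keys_iff)
  then show ?thesis by (simp add: scaleR_poly_mapping_def)
qed

lemma bilinear_coeff_inner: "bilinear (coeff_inner n d)"
  unfolding bilinear_def coeff_inner_def
  by (auto intro!: linearI simp: lookup_add lookup_scaleR algebra_simps sum.distrib sum_distrib_left)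

lemma coeff_inner_commute: "coeff_inner n d f g = coeff_inner n d g f"
  by (simp add: coeff_inner_def mult.commute)

text \<open>A vanishing sum of squares kills the coefficients indexed by
  \<open>multi_indices_upto n d\<close>; membership in \<open>polys_upto n d\<close> kills all the
  others.\<close>

lemma coeff_inner_definite:
  assumes "f \<in> polys_upto n d" "coeff_inner n d f f = 0"
  shows "f = 0"
proof (rule poly_mapping_eqI)
  fix k
  have "\<forall>\<alpha>\<in>multi_indices_upto n d. Poly_Mapping.lookup f \<alpha> * Poly_Mapping.lookup f \<alpha> = 0"
    using assms(2) unfolding coeff_inner_def
    by (subst (asm) sum_nonneg_eq_0_iff) (auto simp: finite_multi_indices_upto)
  then show "Poly_Mapping.lookup f k = Poly_Mapping.lookup 0 k"
    using assms(1) by (auto simp: polys_upto_def in_keys_iff subset_iff)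
qed

lemma subspace_polys_upto: "subspace (polys_upto n d)"
  unfolding subspace_def polys_upto_def
  by (auto simp: subset_iff in_keys_iff lookup_add lookup_scaleR) (metis add_0)

abbreviation single_monom :: "exponent \<Rightarrow> rpoly" where
  "single_monom \<alpha> \<equiv> Poly_Mapping.single \<alpha> 1"

lemma inj_monom: "inj single_monom"
  proof (rule injI)
  fix \<alpha> \<beta> assume "single_monom \<alpha> = single_monom \<beta>"
  then have "Poly_Mapping.keys (single_monom \<alpha>) = Poly_Mapping.keys (single_monom \<beta>)" by simp
  then show "\<alpha> = \<beta>" by simp
qed

lemma lookup_sum_monom:
  assumes "finite A"
  shows "Poly_Mapping.lookup (\<Sum>\<alpha>\<in>A. c \<alpha> *\<^sub>R single_monom \<alpha>) k = (if k \<in> A then c k else 0)"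
  using assms by (simp add: lookup_sum lookup_scaleR lookup_single when_def if_distrib cong: if_cong)

lemma polys_upto_subset_span: "polys_upto n d \<subseteq> span (single_monom ` multi_indices_upto n d)"
proof
  fix f assume f: "f \<in> polys_upto n d"
  have "f = (\<Sum>\<alpha>\<in>multi_indices_upto n d. Poly_Mapping.lookup f \<alpha> *\<^sub>R single_monom \<alpha>)"
    using f by (intro poly_mapping_eqI)
      (auto simp: lookup_sum_monom finite_multi_indices_upto polys_upto_def in_keys_iff subset_iff)
  also have "\<dots> \<in> span (single_monom ` multi_indices_upto n d)"
    by (intro span_sum span_scale span_base) auto
  finally show "f \<in> span (single_monom ` multi_indices_upto n d)" .
qed

lemma independent_monom:
  assumes A: "finite A"
  shows "independent (single_monom ` A)"
proof -
  have inj: "inj_on single_monom A" using inj_monom by (rule inj_on_subset) simp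
  have "u (single_monom \<alpha>) = 0" if "(\<Sum>b\<in>single_monom ` A. u b *\<^sub>R b) = 0" "\<alpha> \<in> A" for u \<alpha>
    using lookup_sum_monom[OF A, of "\<lambda>\<alpha>. u (single_monom \<alpha>)" \<alpha>] that inj by (simp add: sum.reindex)
  then show ?thesis using A by (auto simp: real_vector.dependent_finite)
qed

lemma dim_polys_upto: "real_vector.dim (polys_upto n d) = (n + d) choose d"
proof (rule real_vector.dim_unique[OF _ polys_upto_subset_span])
  show "single_monom ` multi_indices_upto n d \<subseteq> polys_upto n d" by (auto simp: polys_upto_def)
  show "independent (single_monom ` multi_indices_upto n d)"
    by (rule independent_monom[OF finite_multi_indices_upto])
  show "card (single_monom ` multi_indices_upto n d) = (n + d) choose d"
    using inj_monom by (simp add: card_image inj_on_subset card_multi_indices_upto)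
qed

section \<open>Evaluation as an inner product, and dimensions of the two ideals\<close>

definition phi_poly :: "nat \<Rightarrow> nat \<Rightarrow> real vec \<Rightarrow> rpoly" where
  "phi_poly n d x = (\<Sum>\<alpha>\<in>multi_indices_upto n d. monomial_eval n x \<alpha> *\<^sub>R single_monom \<alpha>)"

lemma phi_poly_in_polys_upto: "phi_poly n d x \<in> polys_upto n d"
  by (auto simp: phi_poly_def polys_upto_def in_keys_iff lookup_sum_monom finite_multi_indices_upto
      split: if_splits)

lemma poly_eval_eq_coeff_inner:
  assumes "f \<in> polys_upto n d"
  shows "poly_eval n f x = coeff_inner n d f (phi_poly n d x)"
proof -
  have "poly_eval n f x
      = (\<Sum>\<alpha>\<in>multi_indices_upto n d. Poly_Mapping.lookup f \<alpha> * monomial_eval n x \<alpha>)"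
    unfolding poly_eval_def using assms
    by (intro sum.mono_neutral_left) (auto simp: finite_multi_indices_upto polys_upto_def in_keys_iff)
  then show ?thesis
    by (simp add: coeff_inner_def phi_poly_def lookup_sum_monom finite_multi_indices_upto)
qed

lemma dim_orthogonal_polys_upto:
  assumes "W \<subseteq> polys_upto n d"
  shows "real_vector.dim {u \<in> polys_upto n d. \<forall>w\<in>W. coeff_inner n d w u = 0} + real_vector.dim W
      = (n + d) choose d"
  unfolding dim_polys_upto[symmetric]
  using assms coeff_inner_definite
  by (intro dim_orthogonal_complement[OF bilinear_coeff_inner coeff_inner_commute subspace_polys_upto
        polys_upto_subset_span]) (auto simp: finite_multi_indices_upto)

text \<open>Vanishing at \<open>x\<close> is orthogonality to \<open>phi_poly n d x\<close>, so the
  vanishing ideal is the complement of the image of \<open>Y\<close>, which may be infinite.\<close>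

lemma dim_vanishing_ideal:
  "real_vector.dim (vanishing_ideal n d Y) + real_vector.dim (phi_poly n d ` Y) = (n + d) choose d"
proof -
  have "vanishing_ideal n d Y
      = {u \<in> polys_upto n d. \<forall>w\<in>phi_poly n d ` Y. coeff_inner n d w u = 0}"
    by (auto simp: vanishing_ideal_def poly_eval_eq_coeff_inner coeff_inner_commute)
  then show ?thesis
    using dim_orthogonal_polys_upto[of "phi_poly n d ` Y" n d] phi_poly_in_polys_upto by auto
qed

text \<open>The complement formula a second time, now with the vanishing ideal as \<open>W\<close>.
  Comparing dimensions then avoids identifying the double complement with a span.\<close>

lemma dim_nonvanishing_ideal:
  "real_vector.dim (nonvanishing_ideal n d Y) + real_vector.dim (vanishing_ideal n d Y)
    = (n + d) choose d"
  unfolding nonvanishing_ideal_def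
  by (rule dim_orthogonal_polys_upto) (auto simp: vanishing_ideal_def)

text \<open>More points give a smaller vanishing ideal, hence fewer orthogonality conditions and a
  larger complement.\<close>

lemma dim_nonvanishing_ideal_mono:
  assumes "Y \<subseteq> Z"
  shows "real_vector.dim (nonvanishing_ideal n d Y) \<le> real_vector.dim (nonvanishing_ideal n d Z)"
proof (rule dim_mono_finite)
  show "nonvanishing_ideal n d Y \<subseteq> nonvanishing_ideal n d Z"
    using assms by (auto simp: nonvanishing_ideal_def vanishing_ideal_def)
  show "nonvanishing_ideal n d Z \<subseteq> span (single_monom ` multi_indices_upto n d)"
    using polys_upto_subset_span by (auto simp: nonvanishing_ideal_def)
qed (simp add: finite_multi_indices_upto)

section \<open>The rank of the matrix of monomial vectors\<close>

lemma phi_mat_carrier: "phi_mat n d X \<in> carrier_mat ((n + d) choose d) (dim_col X)"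
  unfolding phi_mat_def using mat_of_cols_carrier(1)[of _ "map (phi n d) (cols X)"] by simp

text \<open>The rank is the dimension of the image of the columns under \<open>phi_poly\<close>.
  That dimension and the one of the nonvanishing ideal both add up with the dimension of the
  vanishing ideal to \<open>(n + d) choose d\<close>, so they agree.\<close>

lemma rank_phi_mat:
  "vec_space.rank ((n + d) choose d) (phi_mat n d X)
    = real_vector.dim (nonvanishing_ideal n d (set (cols X)))"
proof -
  let ?N = "(n + d) choose d" and ?A = "multi_indices_upto n d"
  define as where "as = sorted_list_of_set ?A"
  have as: "set as = ?A" "distinct as" "length as = ?N"
    by (simp_all add: as_def finite_multi_indices_upto card_multi_indices_upto)
  have bij: "bij_betw (nth as) {..<?N} ?A"
    using bij_betw_nth[OF as(2), of "{..<?N}" ?A] as by simp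
  \<comment> \<open>Sending coordinate \<open>i\<close> to the \<open>i\<close>-th monomial in the
    sorted list undoes the ordering built into \<open>phi\<close>.\<close>
  define g :: "real vec \<Rightarrow> rpoly" where "g v = (\<Sum>i<?N. v $ i *\<^sub>R single_monom (as ! i))" for v
  have g_phi: "g (phi n d x) = phi_poly n d x" for x
  proof -
    have "g (phi n d x) = (\<Sum>i<?N. monomial_eval n x (as ! i) *\<^sub>R single_monom (as ! i))"
      unfolding g_def phi_def using as by (intro sum.cong) (auto simp: as_def[symmetric] vec_of_list_index)
    also have "\<dots> = phi_poly n d x"
      unfolding phi_poly_def by (rule sum.reindex_bij_betw[OF bij])
    finally show ?thesis .
  qed
  have "vec_space.rank ?N (phi_mat n d X) = real_vector.dim (g ` set (cols (phi_mat n d X)))"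
  proof (rule rank_eq_dim_linear_image[OF phi_mat_carrier])
    show "inj_on (\<lambda>i. single_monom (as ! i)) {..<?N}"
      using bij inj_monom by (auto simp: inj_on_def bij_betw_def)
    have "(\<lambda>i. single_monom (as ! i)) ` {..<?N} = single_monom ` ?A"
      using bij by (simp add: bij_betw_def image_image[of single_monom "nth as", symmetric])
    then show "independent ((\<lambda>i. single_monom (as ! i)) ` {..<?N})"
      using independent_monom[OF finite_multi_indices_upto] by simp
  qed (simp add: g_def)
  also have "cols (phi_mat n d X) = map (phi n d) (cols X)"
    unfolding phi_mat_def by (rule cols_mat_of_cols) (auto simp: phi_carrier)
  also have "g ` set (map (phi n d) (cols X)) = phi_poly n d ` set (cols X)"
    by (simp add: image_image g_phi)
  finally show ?thesis
    using dim_vanishing_ideal[of n d "set (cols X)"] dim_nonvanishing_ideal[of n d "set (cols X)"]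
    by simp
qed

theorem mainTheorem3:
  fixes n s d :: nat and X :: "real mat"
  assumes "n \<ge> 1" and "s \<ge> 1" and "d \<ge> 1"
    and "X \<in> carrier_mat n s"
  shows "let \<X> = set (cols X);
             N = (n + d) choose d;
             R = real_vector.dim (nonvanishing_ideal n d \<X>)
         in int R = int N - int (real_vector.dim (vanishing_ideal n d \<X>)) \<and>
            vec_space.rank N (phi_mat n d X) = min R s \<and>
            (\<forall>V. real_affine_variety n V \<and> \<X> \<subseteq> V \<longrightarrow>
                vec_space.rank N (phi_mat n d X) \<le> real_vector.dim (nonvanishing_ideal n d V))"
proof -
  let ?X = "set (cols X)" and ?N = "(n + d) choose d"
  have "int (real_vector.dim (nonvanishing_ideal n d ?X))
      = int ?N - int (real_vector.dim (vanishing_ideal n d ?X))"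
    using dim_nonvanishing_ideal[of n d ?X] by linarith
  \<comment> \<open>The rank is already equal to \<open>R\<close>; being at most the number of
    columns, it equals \<open>min R s\<close>.\<close>
  moreover have "vec_space.rank ?N (phi_mat n d X) \<le> s"
    using vec_space.rank_le_nc[OF phi_mat_carrier, of n d X] assms(4) by simp
  ultimately show ?thesis
    using dim_nonvanishing_ideal_mono[of ?X _ n d] by (simp add: Let_def rank_phi_mat)
qed

end
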